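(* Let $(X,d,p,\sigma)$ be a power distance space with $(p,\sigma)\in(\mathbb{R}^*\setminus\{0\})\times\mathbb{R}^+$. Let $\mathcal{B}$ be the set of all open balls in $(X,d)$, and let $T$ be the topology on $X$ induced by $(X,d)$. If $2\sigma\le 2^{1/p}$, then $\mathcal{B}$ is a base for $(X,T)$.
   Context: A distance on a set $X$ is a function $d:X\times X\to\mathbb{R}$ such that for all $x,y\in X$: $d(x,y)\ge 0$; $d(x,y)=0\iff x=y$; $d(x,y)=d(y,x)$. The pair $(X,d)$ is then a distance space. For $x\in X$ and real $r>0$, the open ball is $B(x,r)=\{y\in X\mid d(x,y)<r\}$. A set $U\subseteq X$ is open in $(X,d)$ if for every $x\in U$ there is a real $r>0$ with $B(x,r)\subseteq U$. The topology induced by $(X,d)$ is $T=\{U\subseteq X\mid U\text{ is open in }(X,d)\}$. A family $\mathcal{B}$ is a base for $T$ if $\mathcal{B}\subseteq T$ and every $U\in T$ is a union of members of $\mathcal{B}$. $\mathbb{R}^*=\mathbb{R}\cup\{-\infty,\infty\}$, $\mathbb{R}^+$ is the set of positive reals, and $2^{1/p}=1$ for $p=\pm\infty$. The power triangle function is $\tau(p,\sigma;x,y,z;d)=2\sigma\left[\tfrac12 d^p(x,z)+\tfrac12 d^p(z,y)\right]^{1/p}$, where for $p=\infty,0,-\infty$ it is interpreted by its limit in $p$, namely $2\sigma\max\{d(x,z),d(z,y)\}$, $2\sigma\sqrt{d(x,z)}\sqrt{d(z,y)}$, $2\sigma\min\{d(x,z),d(z,y)\}$ respectively, and for $p<0$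 with $d(x,z)=0$ or $d(z,y)=0$ it is read as its limiting value $0$. The tuple $(X,d,p,\sigma)$, with $(p,\sigma)\in\mathbb{R}^*\times\mathbb{R}^+$, is a power distance space if $(X,d)$ is a distance space and $d(x,y)\le\tau(p,\sigma;x,y,z;d)$ for all $x,y,z\in X$. *)

theory Defs
  imports "HOL-Analysis.Analysis"
begin

definition distance_space :: "'a set \<Rightarrow> ('a \<Rightarrow> 'a \<Rightarrow> real) \<Rightarrow> bool" where
  "distance_space X d \<longleftrightarrow>
     (\<forall>x\<in>X. \<forall>y\<in>X. 0 \<le> d x y \<and> (d x y = 0 \<longleftrightarrow> x = y) \<and> d x y = d y x)"

definition dist_ball :: "'a set \<Rightarrow> ('a \<Rightarrow> 'a \<Rightarrow> real) \<Rightarrow> 'a \<Rightarrow> real \<Rightarrow> 'a set" where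
  "dist_ball X d x r = {y \<in> X. d x y < r}"

definition dist_open :: "'a set \<Rightarrow> ('a \<Rightarrow> 'a \<Rightarrow> real) \<Rightarrow> 'a set \<Rightarrow> bool" where
  "dist_open X d U \<longleftrightarrow> U \<subseteq> X \<and> (\<forall>x\<in>U. \<exists>r>0. dist_ball X d x r \<subseteq> U)"

definition open_balls :: "'a set \<Rightarrow> ('a \<Rightarrow> 'a \<Rightarrow> real) \<Rightarrow> 'a set set" where
  "open_balls X d = {dist_ball X d x r | x r. x \<in> X \<and> r > 0}"

definition dist_topology :: "'a set \<Rightarrow> ('a \<Rightarrow> 'a \<Rightarrow> real) \<Rightarrow> 'a topology" where
  "dist_topology X d = topology (dist_open X d)"

lemma istopology_dist_open: "istopology (dist_open X d)"
  unfolding istopology_def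
proof (intro conjI allI impI)
  fix S T assume S: "dist_open X d S" and T: "dist_open X d T"
  show "dist_open X d (S \<inter> T)"
    unfolding dist_open_def
  proof (intro conjI ballI)
    show "S \<inter> T \<subseteq> X" using S by (auto simp: dist_open_def)
    fix x assume "x \<in> S \<inter> T"
    then obtain r s where "r > 0" "s > 0" "dist_ball X d x r \<subseteq> S" "dist_ball X d x s \<subseteq> T"
      using S T unfolding dist_open_def by blast
    then have "min r s > 0" "dist_ball X d x (min r s) \<subseteq> S \<inter> T"
      by (auto simp: dist_ball_def)
    then show "\<exists>r>0. dist_ball X d x r \<subseteq> S \<inter> T" by blast
  qed
next
  fix K assume K: "\<forall>S\<in>K. dist_open X d S"
  show "dist_open X d (\<Union>K)"
    unfolding dist_open_def
  proof (intro conjI ballI)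
    show "\<Union>K \<subseteq> X" using K by (auto simp: dist_open_def)
    fix x assume "x \<in> \<Union>K"
    then obtain S where "S \<in> K" "x \<in> S" by blast
    moreover from this K obtain r where "r > 0" "dist_ball X d x r \<subseteq> S"
      unfolding dist_open_def by blast
    ultimately show "\<exists>r>0. dist_ball X d x r \<subseteq> \<Union>K" by blast
  qed
qed

lemma openin_dist_topology [simp]: "openin (dist_topology X d) U \<longleftrightarrow> dist_open X d U"
  by (simp add: dist_topology_def istopology_dist_open topology_inverse')

lemma topspace_dist_topology [simp]: "topspace (dist_topology X d) = X"
proof -
  have "dist_open X d X"
    by (auto simp: dist_open_def dist_ball_def intro: exI[of _ 1])
  then show ?thesis
    unfolding topspace_def by (auto simp: dist_open_def)
qed

text \<open>The library's \<^const>\<open>topological_basis\<close> is tied to the type class topology; this is the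
  same notion for an abstract topology with an explicit carrier.\<close>

definition is_base :: "'a set set \<Rightarrow> 'a topology \<Rightarrow> bool" where
  "is_base \<B> T \<longleftrightarrow>
     (\<forall>B\<in>\<B>. openin T B) \<and> (\<forall>U. openin T U \<longrightarrow> (\<exists>\<C>\<subseteq>\<B>. U = \<Union>\<C>))"

text \<open>The values at \<open>\<infinity>\<close>, \<open>-\<infinity>\<close> and \<open>0\<close> are the limits in \<open>p\<close>. For \<open>p < 0\<close> with a vanishing distance
  the limiting value 0 has to be given explicitly, as \<^term>\<open>(0::real) powr p = 0\<close>
  for every \<open>p\<close>.\<close>

definition power_triangle ::
  "ereal \<Rightarrow> real \<Rightarrow> 'a \<Rightarrow> 'a \<Rightarrow> 'a \<Rightarrow> ('a \<Rightarrow> 'a \<Rightarrow> real) \<Rightarrow> real" where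
  "power_triangle p \<sigma> x y z d =
     (if p = \<infinity> then 2 * \<sigma> * max (d x z) (d z y)
      else if p = -\<infinity> then 2 * \<sigma> * min (d x z) (d z y)
      else if p = 0 then 2 * \<sigma> * sqrt (d x z) * sqrt (d z y)
      else if p < 0 \<and> (d x z = 0 \<or> d z y = 0) then 0
      else 2 * \<sigma> * (1/2 * d x z powr real_of_ereal p + 1/2 * d z y powr real_of_ereal p)
             powr (1 / real_of_ereal p))"

definition power_distance_space ::
  "'a set \<Rightarrow> ('a \<Rightarrow> 'a \<Rightarrow> real) \<Rightarrow> ereal \<Rightarrow> real \<Rightarrow> bool" where
  "power_distance_space X d p \<sigma> \<longleftrightarrow>
     distance_space X d \<and> \<sigma> > 0 \<and>
     (\<forall>x\<in>X. \<forall>y\<in>X. \<forall>z\<in>X. d x y \<le> power_triangle p \<sigma> x y z d)"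

text \<open>\<open>2\<^sup>1\<^sup>/\<^sup>p\<close> for nonzero extended real \<open>p\<close>, with the convention \<open>2\<^sup>1\<^sup>/\<^sup>p = 1\<close> for \<open>p = \<plusminus>\<infinity>\<close>;
  the value at \<open>p = 0\<close> is a dummy.\<close>

definition two_root :: "ereal \<Rightarrow> real" where
  "two_root p = (if p = \<infinity> \<or> p = -\<infinity> then 1 else 2 powr (1 / real_of_ereal p))"

end

theory Submission
  imports Defs
begin

text \<open>The bound on \<open>\<sigma>\<close> cancels the factor one half inside the power mean, so that a point \<open>w\<close> with
  \<open>b = d y w\<close> satisfies \<open>d x w \<le> (d x y\<^sup>p + b\<^sup>p)\<^sup>1\<^sup>/\<^sup>p\<close>. For \<open>p > 0\<close> the right-hand side is below \<open>r\<close> as soon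
  as \<open>b < (r\<^sup>p - d x y\<^sup>p)\<^sup>1\<^sup>/\<^sup>p\<close>. For \<open>p < 0\<close> it never exceeds \<open>d x y\<close>, so every nonempty ball is
  all of \<open>X\<close>. For \<open>p = \<plusminus>\<infinity>\<close> the power mean is a maximum or a minimum. Hence balls are open.\<close>

lemma scaled_half_powr_le:
  fixes \<sigma> A q :: real
  assumes "2 * \<sigma> \<le> 2 powr q" "A \<ge> 0"
  shows "2 * \<sigma> * (A / 2) powr q \<le> A powr q"
proof -
  have "2 * \<sigma> * (A / 2) powr q \<le> 2 powr q * (A / 2) powr q"
    using assms by (intro mult_right_mono) auto
  also have "\<dots> = A powr q"
    using assms by (simp flip: powr_mult)
  finally show ?thesis .
qed

text \<open>The second assumption selects the last branch of \<open>power_triangle\<close>, the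
  genuine power mean, away from the prescribed value 0 at vanishing distances.\<close>

lemma power_triangle_real_le:
  assumes "2 * \<sigma> \<le> 2 powr (1 / p)" "p > 0 \<or> d x z \<noteq> 0 \<and> d z y \<noteq> 0" "p \<noteq> 0"
  shows "power_triangle (ereal p) \<sigma> x y z d
           \<le> (d x z powr p + d z y powr p) powr (1 / p)"
  using scaled_half_powr_le[of \<sigma> "1 / p" "d x z powr p + d z y powr p"] assms
  by (auto simp: power_triangle_def add_divide_distrib)

lemma power_triangle_le_if_neg:
  assumes "2 * \<sigma> \<le> two_root p" "p < 0" "d x z \<ge> 0" "d z y \<ge> 0" "\<sigma> > 0"
  shows "power_triangle p \<sigma> x y z d \<le> d x z"
proof (cases p)
  case (real q)
  have q: "q < 0" using assms real by simp
  show ?thesis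
  proof (cases "d x z = 0 \<or> d z y = 0")
    case True
    then show ?thesis using q real assms by (auto simp: power_triangle_def)
  next
    case False
    have "power_triangle p \<sigma> x y z d \<le> (d x z powr q + d z y powr q) powr (1 / q)"
      using power_triangle_real_le[of \<sigma> q d x z y] assms(1) False q real
      by (simp add: two_root_def)
    \<comment> \<open>As \<open>1 / q\<close> is negative, the outer power is decreasing on positive
      reals, so dropping a nonnegative summand enlarges the value.\<close>
    also have "\<dots> \<le> (d x z powr q) powr (1 / q)"
      using False q by (intro powr_mono2') auto
    also have "\<dots> = d x z"
      using False assms q by (simp add: powr_powr)
    finally show ?thesis .
  qed
next
  case MInf
  have "2 * \<sigma> * min (d x z) (d z y) \<le> 1 * min (d x z) (d z y)"
    using assms MInf by (intro mult_right_mono) (auto simp: two_root_def)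
  then show ?thesis using MInf by (simp add: power_triangle_def)
qed (use assms in auto)

text \<open>The bound \<open>s\<close> is chosen before the points: it depends only on
  \<open>p\<close>, \<open>a\<close> and \<open>r\<close>, so one radius serves all points near the
  intermediate point \<open>z\<close>.\<close>

lemma power_triangle_less_if_pos:
  assumes "2 * \<sigma> \<le> two_root p" "p > 0" "\<sigma> > 0" "a \<ge> 0" "a < r"
  shows "\<exists>s>0. \<forall>x y z. d x z = a \<longrightarrow> 0 \<le> d z y \<longrightarrow> d z y < s \<longrightarrow> power_triangle p \<sigma> x y z d < r"
proof (cases p)
  case (real q)
  have q: "q > 0" using assms real by simp
  \<comment> \<open>The solution of \<open>a powr q + s powr q = r powr q\<close>; it is positive
    because \<open>a < r\<close>.\<close>
  define s where "s = (r powr q - a powr q) powr (1 / q)"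
  have pos: "r powr q - a powr q > 0"
    using assms q by (simp add: powr_less_mono2)
  have sq: "s powr q = r powr q - a powr q"
    using pos q by (simp add: s_def powr_powr)
  have "power_triangle p \<sigma> x y z d < r" if "d x z = a" "0 \<le> d z y" "d z y < s" for x y z
  proof -
    have "power_triangle p \<sigma> x y z d \<le> (a powr q + d z y powr q) powr (1 / q)"
      using power_triangle_real_le[of \<sigma> q d x z y] assms(1) q real that(1)
      by (simp add: two_root_def)
    also have "\<dots> < (r powr q) powr (1 / q)"
      using q sq powr_less_mono2[OF q that(2,3)] by (intro powr_less_mono2) auto
    also have "\<dots> = r"
      using assms q by (simp add: powr_powr)
    finally show ?thesis .
  qed
  moreover have "s > 0" using pos by (simp add: s_def)
  ultimately show ?thesis by blast
next
  case PInf
  have "power_triangle p \<sigma> x y z d < r" if "d x z = a" "0 \<le> d z y" "d z y < r" for x y z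
  proof -
    have "2 * \<sigma> * max (d x z) (d z y) \<le> 1 * max (d x z) (d z y)"
      using assms PInf that by (intro mult_right_mono) (auto simp: two_root_def)
    then show ?thesis using PInf that assms by (simp add: power_triangle_def)
  qed
  \<comment> \<open>With \<open>2 * \<sigma> \<le> 1\<close>, the maximum of two distances below
    \<open>r\<close> stays below \<open>r\<close>, so \<open>r\<close> itself serves as
    \<open>s\<close>.\<close>
  then show ?thesis using assms by (intro exI[of _ r]) auto
qed (use assms in auto)

lemma dist_open_dist_ball:
  assumes pds: "power_distance_space X d p \<sigma>"
    and p: "p \<noteq> 0" "2 * \<sigma> \<le> two_root p"
    and x: "x \<in> X"
  shows "dist_open X d (dist_ball X d x r)"
  unfolding dist_open_def
proof (intro conjI ballI)
  show "dist_ball X d x r \<subseteq> X" by (auto simp: dist_ball_def)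
  fix y assume "y \<in> dist_ball X d x r"
  then have y: "y \<in> X" "d x y < r" by (auto simp: dist_ball_def)
  have \<sigma>: "\<sigma> > 0" and nonneg: "\<And>u v. u \<in> X \<Longrightarrow> v \<in> X \<Longrightarrow> 0 \<le> d u v"
    \<comment> \<open>The ball point \<open>y\<close> is the intermediate point, so the fixed
      distance \<open>d x y\<close> is combined with the small distance
      \<open>d y w\<close>.\<close>
    and tri: "\<And>w. w \<in> X \<Longrightarrow> d x w \<le> power_triangle p \<sigma> x w y d"
    using pds x y by (auto simp: power_distance_space_def distance_space_def)
  have "\<exists>s>0. \<forall>w\<in>X. d y w < s \<longrightarrow> power_triangle p \<sigma> x w y d < r"
  proof (cases "p > 0")
    case True
    show ?thesis
      using power_triangle_less_if_pos[OF p(2) True \<sigma> nonneg[OF x y(1)] y(2), of d] nonneg y(1)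
      by blast
  next
    case False
    then have neg: "p < 0" using p by auto
    have "power_triangle p \<sigma> x w y d < r" if "w \<in> X" for w
      using power_triangle_le_if_neg[of \<sigma> p d x y w, OF p(2) neg] nonneg[OF x y(1)]
        nonneg[OF y(1) that] \<sigma> y(2) by linarith
    \<comment> \<open>The bound holds for every \<open>w\<close> in \<open>X\<close>, so any
      positive radius would do.\<close>
    then show ?thesis by (intro exI[of _ 1]) auto
  qed
  then obtain s where s: "s > 0" "\<And>w. w \<in> X \<Longrightarrow> d y w < s \<Longrightarrow> power_triangle p \<sigma> x w y d < r"
    by blast
  then have "dist_ball X d y s \<subseteq> dist_ball X d x r"
    using le_less_trans[OF tri] by (auto simp: dist_ball_def)
  with s(1) show "\<exists>s>0. dist_ball X d y s \<subseteq> dist_ball X d x r" by blast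
qed

text \<open>Each point of \<open>U\<close> lies in a ball around itself inside \<open>U\<close>,
  because \<open>d x x = 0\<close>. The power triangle inequality enters only through the openness
  of balls.\<close>

lemma dist_open_eq_Union_open_balls:
  assumes "distance_space X d" "dist_open X d U"
  shows "U = \<Union>{B \<in> open_balls X d. B \<subseteq> U}"
proof
  show "U \<subseteq> \<Union>{B \<in> open_balls X d. B \<subseteq> U}"
  proof
    fix x assume x: "x \<in> U"
    then obtain r where r: "r > 0" "dist_ball X d x r \<subseteq> U" and X: "x \<in> X"
      using assms(2) unfolding dist_open_def by blast
    have "d x x = 0" using assms(1) X unfolding distance_space_def by blast
    then have "x \<in> dist_ball X d x r" using X r by (simp add: dist_ball_def)
    moreover have "dist_ball X d x r \<in> open_balls X d"
      using X r unfolding open_balls_def by blast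
    ultimately show "x \<in> \<Union>{B \<in> open_balls X d. B \<subseteq> U}" using r by blast
  qed
qed auto

theorem corollary4p12:
  fixes X :: "'a set" and d :: "'a \<Rightarrow> 'a \<Rightarrow> real" and p :: ereal and \<sigma> :: real
  assumes "power_distance_space X d p \<sigma>"
    and "p \<noteq> 0"
    and "2 * \<sigma> \<le> two_root p"
  shows "is_base (open_balls X d) (dist_topology X d)"
proof -
  have "distance_space X d"
    using assms(1) by (simp add: power_distance_space_def)
  then have "\<exists>\<C>\<subseteq>open_balls X d. U = \<Union>\<C>" if "dist_open X d U" for U
    using dist_open_eq_Union_open_balls[OF _ that]
    by (intro exI[of _ "{B \<in> open_balls X d. B \<subseteq> U}"]) blast
  then show ?thesis
    using dist_open_dist_ball[OF assms] unfolding is_base_def open_balls_def openin_dist_topology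
    by blast
qed

end
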